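(* Let $X$ be an irreducible continuous-time Markov process on a finite set $\mathcal{X}$ with kernel $p$, reversible with respect to the probability measure $\mu$, and let $\mathcal{R}\subset\mathcal{X}$ be such that the restricted processes $X_{\mathcal{R}}$ and $X_{\mathcal{X}\setminus\mathcal{R}}$ are irreducible. If $\varepsilon^*_{\mathcal{R}}<1$, then $$\mathrm{Var}_{\mu_{\mathcal{R}}}(h^*_{\mathcal{R}})=\|h^*_{\mathcal{R}}-\mathbf{1}_{\mathcal{R}}\|^2_{\mathcal{R}}\le\frac{\varepsilon^*_{\mathcal{R}}}{1-\varepsilon^*_{\mathcal{R}}}.$$
   Context: $X$ has generator $\mathcal{L}f(x)=\sum_{y\in\mathcal{X}}p(x,y)(f(y)-f(x))$ with $p\ge0$, $\sum_yp(x,y)=1$, $\mu(x)p(x,y)=\mu(y)p(y,x)$. $\mathcal{R}$ is a nonempty proper subset with at least two elements. The restricted process $X_{\mathcal{R}}$ on $\mathcal{R}$ has kernel $p_{\mathcal{R}}(x,y)=p(x,y)$ for $x\ne y$, $p_{\mathcal{R}}(x,x)=p(x,x)+\sum_{y\notin\mathcal{R}}p(x,y)$ (similarly for $\mathcal{X}\setminus\mathcal{R}$); it is reversible with respect to $\mu_{\mathcal{R}}=\mu(\cdot\mid\mathcal{R})$, with spectral gap $\gamma_{\mathcal{R}}=\min_{\mathrm{Var}_{\mu_{\mathcal{R}}}(f)\ne0}\mathcal{D}_{\mathcal{R}}(f)/\mathrm{Var}_{\mu_{\mathcal{R}}}(f)$, $\mathcal{D}_{\mathcal{R}}(f)=\frac12\sum_{x,y\in\mathcal{R}}\mu_{\mathcal{R}}(x)p_{\mathcal{R}}(x,y)(f(x)-f(y))^2$.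 Let $p^*_{\mathcal{R}}(x,y)=p(x,y)$, $x,y\in\mathcal{R}$; $1-\phi^*_{\mathcal{R}}$ is its spectral radius, and $\mu^*_{\mathcal{R}}$ the unique probability measure on $\mathcal{R}$ with $\mu^*_{\mathcal{R}}p^*_{\mathcal{R}}=(1-\phi^*_{\mathcal{R}})\mu^*_{\mathcal{R}}$. Set $\varepsilon^*_{\mathcal{R}}=\phi^*_{\mathcal{R}}/\gamma_{\mathcal{R}}$, $h^*_{\mathcal{R}}(x)=\mu^*_{\mathcal{R}}(x)/\mu_{\mathcal{R}}(x)$ for $x\in\mathcal{R}$, and $\|f\|_{\mathcal{R}}^2=\sum_{x\in\mathcal{R}}\mu_{\mathcal{R}}(x)f(x)^2$. *)

theory Defs
  imports "HOL-Probability.Probability" "Jordan_Normal_Form.Spectral_Radius"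
begin

text \<open>
  A continuous-time Markov process on a finite type with generator
  \<open>L f x = (\<Sum>y. p x y * (f y - f x))\<close> is represented by its stochastic kernel \<open>p\<close>.
  Kernels on a subset \<open>S\<close> are total functions of which only the values on \<open>S \<times> S\<close> matter.
\<close>

definition stochastic_kernel :: "('a::finite \<Rightarrow> 'a \<Rightarrow> real) \<Rightarrow> bool" where
  "stochastic_kernel p \<longleftrightarrow> (\<forall>x y. 0 \<le> p x y) \<and> (\<forall>x. (\<Sum>y\<in>UNIV. p x y) = 1)"

definition reversible :: "('a \<Rightarrow> 'a \<Rightarrow> real) \<Rightarrow> 'a pmf \<Rightarrow> bool" where
  "reversible p \<mu> \<longleftrightarrow> (\<forall>x y. pmf \<mu> x * p x y = pmf \<mu> y * p y x)"

definition irreducible_on :: "'a set \<Rightarrow> ('a \<Rightarrow> 'a \<Rightarrow> real) \<Rightarrow> bool" where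
  "irreducible_on S q \<longleftrightarrow>
     (\<forall>x\<in>S. \<forall>y\<in>S. (x, y) \<in> {(u, v). u \<in> S \<and> v \<in> S \<and> 0 < q u v}\<^sup>*)"

text \<open>Jumps leaving \<open>S\<close> are suppressed, and their rate is put on the diagonal.\<close>

definition restricted_kernel ::
    "('a::finite \<Rightarrow> 'a \<Rightarrow> real) \<Rightarrow> 'a set \<Rightarrow> 'a \<Rightarrow> 'a \<Rightarrow> real" where
  "restricted_kernel p S x y = (if x = y then p x x + (\<Sum>z\<in>-S. p x z) else p x y)"

text \<open>\<open>cond_pmf \<mu> S\<close> is \<open>\<mu>(\<cdot> | S)\<close>; it is unspecified if \<open>\<mu>\<close> gives no mass to \<open>S\<close>.\<close>

definition dirichlet_form ::
    "('a::finite \<Rightarrow> 'a \<Rightarrow> real) \<Rightarrow> 'a pmf \<Rightarrow> 'a set \<Rightarrow> ('a \<Rightarrow> real) \<Rightarrow> real" where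
  "dirichlet_form p \<mu> S f =
     1 / 2 * (\<Sum>x\<in>S. \<Sum>y\<in>S. pmf (cond_pmf \<mu> S) x * restricted_kernel p S x y * (f x - f y)\<^sup>2)"

text \<open>If \<open>\<mu>\<close> is positive on \<open>S\<close> and \<open>S\<close> has at least two points, this infimum is a
  minimum: the quotient is invariant under adding constants and scaling, so that
  \<open>f\<close> may be taken from a compact set of centred functions of unit variance.\<close>

definition spectral_gap :: "('a::finite \<Rightarrow> 'a \<Rightarrow> real) \<Rightarrow> 'a pmf \<Rightarrow> 'a set \<Rightarrow> real" where
  "spectral_gap p \<mu> S =
     Inf {dirichlet_form p \<mu> S f / measure_pmf.variance (cond_pmf \<mu> S) f | f.
            measure_pmf.variance (cond_pmf \<mu> S) f \<noteq> 0}"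

text \<open>The sub-stochastic kernel of the process killed outside \<open>S\<close>, as a complex matrix. For
  finite \<open>S\<close>, \<open>from_nat_into S\<close> enumerates \<open>S\<close> bijectively on \<open>{..<card S}\<close>; the spectrum
  does not depend on the enumeration.\<close>

definition killed_matrix :: "('a \<Rightarrow> 'a \<Rightarrow> real) \<Rightarrow> 'a set \<Rightarrow> complex mat" where
  "killed_matrix p S = mat (card S) (card S)
     (\<lambda>(i, j). complex_of_real (p (from_nat_into S i) (from_nat_into S j)))"

definition phi_star :: "('a \<Rightarrow> 'a \<Rightarrow> real) \<Rightarrow> 'a set \<Rightarrow> real" where
  "phi_star p S = 1 - spectral_radius (killed_matrix p S)"

definition mu_star :: "('a \<Rightarrow> 'a \<Rightarrow> real) \<Rightarrow> 'a set \<Rightarrow> 'a pmf" where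
  "mu_star p S = (THE \<nu>. set_pmf \<nu> \<subseteq> S \<and>
     (\<forall>y\<in>S. (\<Sum>x\<in>S. pmf \<nu> x * p x y) = (1 - phi_star p S) * pmf \<nu> y))"

definition eps_star :: "('a::finite \<Rightarrow> 'a \<Rightarrow> real) \<Rightarrow> 'a pmf \<Rightarrow> 'a set \<Rightarrow> real" where
  "eps_star p \<mu> S = phi_star p S / spectral_gap p \<mu> S"

definition h_star :: "('a \<Rightarrow> 'a \<Rightarrow> real) \<Rightarrow> 'a pmf \<Rightarrow> 'a set \<Rightarrow> 'a \<Rightarrow> real" where
  "h_star p \<mu> S x = pmf (mu_star p S) x / pmf (cond_pmf \<mu> S) x"

definition norm_restr :: "'a pmf \<Rightarrow> 'a set \<Rightarrow> ('a \<Rightarrow> real) \<Rightarrow> real" where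
  "norm_restr \<mu> S f = sqrt (\<Sum>x\<in>S. pmf (cond_pmf \<mu> S) x * (f x)\<^sup>2)"

end

theory Submission
  imports Defs
begin

text \<open>
  By reversibility \<open>h\<^sup>*\<close> is the Perron eigenfunction of the killed kernel, which is self-adjoint on
  \<open>L\<^sup>2(\<mu>\<^sub>R)\<close>: passing from \<open>f\<close> to \<open>\<bar>f\<bar>\<close> does not decrease the Rayleigh quotient, so its maximum
  is attained at a nonnegative function and equals the spectral radius. Since the Dirichlet form of the restricted process omits the killing term,
  \<open>\<gamma> Var(h\<^sup>*) \<le> D(h\<^sup>*) \<le> \<phi>\<^sup>* \<parallel>h\<^sup>*\<parallel>\<^sup>2 = \<phi>\<^sup>* (Var(h\<^sup>*) + 1)\<close>, and it remains to solve for the variance.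
\<close>

unbundle no vec_syntax

section \<open>Maximizing the Rayleigh quotient\<close>

text \<open>The first-order condition behind the eigenvalue equation of a Rayleigh maximizer: for
  small \<open>t\<close> of suitable sign the linear term would dominate and make the sum
  negative.\<close>

lemma linear_coefficient_eq_0:
  fixes a b :: real
  assumes "\<And>t. 0 \<le> t * a + t\<^sup>2 * b"
  shows "a = 0"
proof (rule ccontr)
  assume "a \<noteq> 0"
  \<comment> \<open>Any positive \<open>c > b\<close> works, since at \<open>t = - a / c\<close> the
    sum equals \<open>(a / c)^2 * (b - c)\<close>.\<close>
  define c where "c = 2 * (\<bar>b\<bar> + 1)"
  have c: "0 < c" by (simp add: c_def)
  have "0 \<le> (- a / c) * a + (- a / c)\<^sup>2 * b" by (rule assms)
  also have "(- a / c) * a = - (a\<^sup>2 / c\<^sup>2 * c)"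
    using c by (simp add: power2_eq_square)
  also have "- (a\<^sup>2 / c\<^sup>2 * c) + (- a / c)\<^sup>2 * b = a\<^sup>2 / c\<^sup>2 * (b - c)"
    by (simp add: power_divide right_diff_distrib)
  finally have "0 \<le> a\<^sup>2 / c\<^sup>2 * (b - c)" .
  moreover have "0 < a\<^sup>2 / c\<^sup>2" using \<open>a \<noteq> 0\<close> c by simp
  ultimately have "c \<le> b" by (meson diff_ge_0_iff_ge linorder_not_le mult_pos_neg not_le)
  then show False by (simp add: c_def)
qed

text \<open>The form is continuous on a compact sphere, so it attains its maximum \<open>M\<close>
  there; homogeneity of degree two extends the bound to every \<open>f\<close>. Nonnegativity of
  \<open>K\<close> permits replacing the maximizer by its absolute value.\<close>

lemma rayleigh_maximizer:
  fixes K :: "'a::finite \<Rightarrow> 'a \<Rightarrow> real"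
  assumes "S \<noteq> {}"
    and nonneg: "\<And>x y. x \<in> S \<Longrightarrow> y \<in> S \<Longrightarrow> 0 \<le> K x y"
    and w: "\<And>x. x \<in> S \<Longrightarrow> 0 < w x"
  obtains M h where "\<And>x. 0 \<le> h x" and "\<exists>x\<in>S. 0 < h x"
    and "(\<Sum>x\<in>S. \<Sum>y\<in>S. K x y * h x * h y) = M * (\<Sum>x\<in>S. w x * (h x)\<^sup>2)"
    and "\<And>f. (\<Sum>x\<in>S. \<Sum>y\<in>S. K x y * f x * f y) \<le> M * (\<Sum>x\<in>S. w x * (f x)\<^sup>2)"
proof -
  define B where "B f = (\<Sum>x\<in>S. \<Sum>y\<in>S. K x y * f x * f y)" for f
  define N where "N f = (\<Sum>x\<in>S. w x * (f x)\<^sup>2)" for f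
  \<comment> \<open>Cartesian vectors are indexed by a whole type, so the unit sphere of functions
    on \<open>S\<close> is obtained by setting all other coordinates to zero.\<close>
  define T where "T = sphere 0 1 \<inter> (\<Inter>x\<in>-S. {v :: (real, 'a) Finite_Cartesian_Product.vec. vec_nth v x = 0})"
  \<comment> \<open>This rescaling turns the Euclidean norm into the weighted norm
    \<open>N\<close>.\<close>
  define q where "q v x = vec_nth v x / sqrt (w x)" for v :: "(real, 'a) Finite_Cartesian_Product.vec" and x
  have Nq: "N (q v) = (norm v)\<^sup>2" if "\<And>x. x \<notin> S \<Longrightarrow> vec_nth v x = 0" for v
  proof -
    have "N (q v) = (\<Sum>x\<in>S. (vec_nth v x)\<^sup>2)"
      unfolding N_def q_def
      by (rule sum.cong) (use w in \<open>auto simp: power_divide less_imp_le, metis less_irrefl\<close>)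
    also have "\<dots> = (\<Sum>x\<in>UNIV. (vec_nth v x)\<^sup>2)"
      by (rule sum.mono_neutral_left) (use that in auto)
    also have "\<dots> = (norm v)\<^sup>2"
      by (simp add: norm_vec_def L2_set_def sum_nonneg)
    finally show ?thesis .
  qed
  obtain x0 where "x0 \<in> S" using \<open>S \<noteq> {}\<close> by auto
  then have "axis x0 1 \<in> T" by (auto simp: T_def norm_axis_1) (auto simp: axis_def)
  then have "T \<noteq> {}" by auto
  have "compact T"
    unfolding T_def by (intro compact_Int_closed closed_INT ballI closed_Collect_eq continuous_intros) auto
  moreover have "continuous_on T (\<lambda>v. B (q v))"
    unfolding B_def q_def divide_inverse by (intro continuous_intros)
  ultimately obtain v where v: "v \<in> T" "\<And>u. u \<in> T \<Longrightarrow> B (q u) \<le> B (q v)"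
    using continuous_attains_sup[OF _ \<open>T \<noteq> {}\<close>] by blast
  define M where "M = B (q v)"
  have bound: "B f \<le> M * N f" for f
  proof -
    \<comment> \<open>The inverse of the rescaling \<open>q\<close> on \<open>S\<close>, extended by
      zero.\<close>
    define u :: "(real, 'a) Finite_Cartesian_Product.vec" where "u = vec_lambda (\<lambda>x. if x \<in> S then sqrt (w x) * f x else 0)"
    have qu: "q u x = f x" if "x \<in> S" for x
      using w[OF that] that by (simp add: q_def u_def)
    have B: "B (q u) = B f" and N: "N (q u) = N f"
      by (simp_all add: B_def N_def qu)
    have nu: "N f = (norm u)\<^sup>2"
      using Nq[of u] N by (simp add: u_def)
    show ?thesis
    proof (cases "u = 0")
      case True
      then have "q u = (\<lambda>_. 0)" by (simp add: q_def fun_eq_iff)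
      then show ?thesis using B N by (simp add: B_def N_def)
    next
      case False
      define a where "a = norm u"
      have a: "a > 0" using False by (simp add: a_def)
      have "(1 / a) *\<^sub>R u \<in> T"
        using a by (auto simp: T_def a_def u_def)
      then have "B (q ((1 / a) *\<^sub>R u)) \<le> M" unfolding M_def by (rule v)
      moreover have "B (q ((1 / a) *\<^sub>R u)) = B (q u) / a\<^sup>2"
        unfolding B_def sum_divide_distrib
        by (intro sum.cong) (simp_all add: q_def power2_eq_square)
      ultimately show ?thesis using B nu a by (simp add: field_simps a_def)
    qed
  qed
  define h where "h x = \<bar>q v x\<bar>" for x
  have Nv: "N (q v) = 1" using v(1) Nq[of v] by (simp add: T_def)
  have Nh: "N h = 1" using Nv by (simp add: N_def h_def)
  have "M \<le> B h"
    unfolding M_def B_def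
  proof (intro sum_mono)
    fix x y assume "x \<in> S" "y \<in> S"
    then have "K x y * (q v x * q v y) \<le> K x y * (h x * h y)"
      by (intro mult_left_mono nonneg) (simp_all add: h_def abs_mult[symmetric])
    then show "K x y * q v x * q v y \<le> K x y * h x * h y" by (simp add: mult.assoc)
  qed
  moreover have "B h \<le> M" using bound[of h] Nh by simp
  ultimately have "B h = M * N h" using Nh by simp
  moreover have "\<exists>x\<in>S. 0 < h x"
  proof (rule ccontr)
    assume "\<not> ?thesis"
    then have "\<forall>x\<in>S. h x = 0" by (auto simp: h_def)
    then show False using Nh by (simp add: N_def)
  qed
  ultimately show thesis
    using bound that[of h M] by (auto simp: B_def N_def h_def)
qed

text \<open>Euler-Lagrange equation: the right side of \<open>le\<close> minus its left side is
  nonnegative and vanishes at \<open>h\<close>, so its derivative at \<open>h\<close> in the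
  direction of each point mass is zero.\<close>

lemma rayleigh_maximizer_eigenfunction:
  fixes K :: "'a \<Rightarrow> 'a \<Rightarrow> real"
  assumes "finite S" and sym: "\<And>x y. x \<in> S \<Longrightarrow> y \<in> S \<Longrightarrow> K x y = K y x"
    and eq: "(\<Sum>x\<in>S. \<Sum>y\<in>S. K x y * h x * h y) = M * (\<Sum>x\<in>S. w x * (h x)\<^sup>2)"
    and le: "\<And>f. (\<Sum>x\<in>S. \<Sum>y\<in>S. K x y * f x * f y) \<le> M * (\<Sum>x\<in>S. w x * (f x)\<^sup>2)"
    and "z \<in> S"
  shows "(\<Sum>y\<in>S. K z y * h y) = M * (w z * h z)"
proof -
  \<comment> \<open>\<open>d\<close> is the point mass at \<open>z\<close>; \<open>a\<close> and
    \<open>b\<close> are the coefficients of \<open>t\<close> and \<open>t^2\<close> in that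
    difference at \<open>h + t d\<close>, whose constant term vanishes by \<open>eq\<close>.\<close>
  define d where "d = (\<lambda>x. if x = z then 1 else 0 :: real)"
  define a where "a = 2 * (M * (w z * h z) - (\<Sum>y\<in>S. K z y * h y))"
  define b where "b = M * w z - K z z"
  have "0 \<le> t * a + t\<^sup>2 * b" for t
  proof -
    \<comment> \<open>Symmetry makes the two mixed terms of the expansion coincide.\<close>
    have cols: "(\<Sum>x\<in>S. K x z * h x) = (\<Sum>y\<in>S. K z y * h y)"
      by (rule sum.cong) (use sym \<open>z \<in> S\<close> in auto)
    have "(\<Sum>x\<in>S. \<Sum>y\<in>S. K x y * (h x + t * d x) * (h y + t * d y))
        = (\<Sum>x\<in>S. \<Sum>y\<in>S. K x y * h x * h y + t * (K x y * h y * d x)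
            + t * (K x y * h x * d y) + t\<^sup>2 * (K x y * d x * d y))"
      by (intro sum.cong refl) (simp add: algebra_simps power2_eq_square)
    also have "\<dots> = (\<Sum>x\<in>S. \<Sum>y\<in>S. K x y * h x * h y)
          + t * (\<Sum>x\<in>S. \<Sum>y\<in>S. K x y * h y * d x)
          + t * (\<Sum>x\<in>S. \<Sum>y\<in>S. K x y * h x * d y)
          + t\<^sup>2 * (\<Sum>x\<in>S. \<Sum>y\<in>S. K x y * d x * d y)"
      by (simp only: sum.distrib sum_distrib_left)
    also have "(\<Sum>x\<in>S. \<Sum>y\<in>S. K x y * h y * d x) = (\<Sum>y\<in>S. K z y * h y)"
      by (subst sum.swap)
        (use \<open>finite S\<close> \<open>z \<in> S\<close> in \<open>simp add: d_def if_distrib[of "\<lambda>c. _ * c"] cong: if_cong\<close>)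
    also have "(\<Sum>x\<in>S. \<Sum>y\<in>S. K x y * h x * d y) = (\<Sum>y\<in>S. K z y * h y)"
      using \<open>finite S\<close> \<open>z \<in> S\<close> cols by (simp add: d_def if_distrib[of "\<lambda>c. _ * c"] cong: if_cong)
    also have "(\<Sum>x\<in>S. \<Sum>y\<in>S. K x y * d x * d y) = K z z"
      using \<open>finite S\<close> \<open>z \<in> S\<close> by (simp add: d_def if_distrib[of "\<lambda>c. _ * c"] cong: if_cong)
    finally have B: "(\<Sum>x\<in>S. \<Sum>y\<in>S. K x y * (h x + t * d x) * (h y + t * d y))
        = (\<Sum>x\<in>S. \<Sum>y\<in>S. K x y * h x * h y) + 2 * t * (\<Sum>y\<in>S. K z y * h y) + t\<^sup>2 * K z z"
      by simp
    have "(\<Sum>x\<in>S. w x * (h x + t * d x)\<^sup>2)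
        = (\<Sum>x\<in>S. w x * (h x)\<^sup>2 + 2 * t * (w x * h x * d x) + t\<^sup>2 * (w x * d x * d x))"
      by (intro sum.cong refl) (simp add: algebra_simps power2_eq_square)
    also have "\<dots> = (\<Sum>x\<in>S. w x * (h x)\<^sup>2) + 2 * t * (\<Sum>x\<in>S. w x * h x * d x)
        + t\<^sup>2 * (\<Sum>x\<in>S. w x * d x * d x)"
      by (simp only: sum.distrib sum_distrib_left)
    also have "(\<Sum>x\<in>S. w x * h x * d x) = w z * h z"
      using \<open>finite S\<close> \<open>z \<in> S\<close> by (simp add: d_def if_distrib[of "\<lambda>c. _ * c"] cong: if_cong)
    also have "(\<Sum>x\<in>S. w x * d x * d x) = w z"
      using \<open>finite S\<close> \<open>z \<in> S\<close> by (simp add: d_def if_distrib[of "\<lambda>c. _ * c"] cong: if_cong)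
    finally show ?thesis
      using le[of "\<lambda>x. h x + t * d x"] B eq by (simp add: a_def b_def algebra_simps)
  qed
  then have "a = 0" by (rule linear_coefficient_eq_0)
  then show ?thesis by (simp add: a_def)
qed

section \<open>Perron-Frobenius theory of the killed kernel\<close>

text \<open>\<open>M\<close> is itself an eigenvalue, with eigenvector \<open>h\<close>. Conversely,
  the entrywise modulus of a complex eigenvector for an eigenvalue \<open>c\<close> of maximal
  modulus is a subsolution for \<open>norm c\<close>, and testing the Rayleigh bound on it gives
  \<open>norm c \<le> M\<close>.\<close>

lemma spectral_radius_killed_matrix:
  fixes p :: "'a::finite \<Rightarrow> 'a \<Rightarrow> real"
  assumes p: "\<And>x y. 0 \<le> p x y" and w: "\<And>x. x \<in> S \<Longrightarrow> 0 < w x"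
    and "x0 \<in> S" "h x0 \<noteq> 0"
    and eig: "\<And>x. x \<in> S \<Longrightarrow> (\<Sum>y\<in>S. p x y * h y) = M * h x"
    and le: "\<And>f. (\<Sum>x\<in>S. \<Sum>y\<in>S. w x * p x y * f x * f y) \<le> M * (\<Sum>x\<in>S. w x * (f x)\<^sup>2)"
  shows "spectral_radius (killed_matrix p S) = M"
proof (rule antisym)
  define n where "n = card S"
  define e where "e = from_nat_into S"
  define A where "A = killed_matrix p S"
  have e: "bij_betw e {..<n} S"
    unfolding e_def n_def by (rule bij_betw_from_nat_into_finite) simp
  have eS: "e i \<in> S" if "i < n" for i using e that by (auto simp: bij_betw_def)
  have sum_e: "(\<Sum>x\<in>S. g x) = (\<Sum>i<n. g (e i))" for g :: "'a \<Rightarrow> real"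
    by (rule sum.reindex_bij_betw[OF e, symmetric])
  have "0 < n" using \<open>x0 \<in> S\<close> by (auto simp: n_def card_gt_0_iff)
  have A: "A \<in> carrier_mat n n" by (simp add: A_def killed_matrix_def n_def)
  have Av: "(A *\<^sub>v v) $ i = (\<Sum>j<n. of_real (p (e i) (e j)) * v $ j)"
    if "i < n" "v \<in> carrier_vec n" for v i
    using that by (simp add: A_def killed_matrix_def n_def e_def scalar_prod_def lessThan_atLeast0)
  show "M \<le> spectral_radius A"
  proof -
    define v where "v = Matrix.vec n (\<lambda>i. complex_of_real (h (e i)))"
    have v: "v \<in> carrier_vec n" by (simp add: v_def)
    obtain i0 where "i0 < n" "e i0 = x0" using e \<open>x0 \<in> S\<close> by (auto simp: bij_betw_def)
    then have "v \<noteq> 0\<^sub>v n"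
      using \<open>h x0 \<noteq> 0\<close> by (metis index_vec index_zero_vec(1) of_real_eq_0_iff v_def)
    moreover have "A *\<^sub>v v = of_real M \<cdot>\<^sub>v v"
    proof (rule eq_vecI)
      fix i assume "i < dim_vec (of_real M \<cdot>\<^sub>v v)"
      then have i: "i < n" by (simp add: v_def)
      have "(A *\<^sub>v v) $ i = of_real (\<Sum>j<n. p (e i) (e j) * h (e j))"
        using i by (simp add: Av v) (simp add: v_def)
      also have "(\<Sum>j<n. p (e i) (e j) * h (e j)) = M * h (e i)"
        using eig[OF eS[OF i]] by (simp add: sum_e)
      finally show "(A *\<^sub>v v) $ i = (of_real M \<cdot>\<^sub>v v) $ i"
        using i by (simp add: v_def)
    qed (use A in \<open>simp add: v_def\<close>)
    ultimately have "eigenvalue A (of_real M)"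
      using A v unfolding eigenvalue_def eigenvector_def by auto
    then have "norm (complex_of_real M) \<le> spectral_radius A"
      by (intro spectral_radius_mem_max(2)[OF A \<open>0 < n\<close>] imageI) (simp add: spectrum_def)
    then show ?thesis by simp
  qed
  show "spectral_radius A \<le> M"
  proof -
    obtain c where c: "c \<in> spectrum A" "spectral_radius A = norm c"
      using spectral_radius_mem_max(1)[OF A \<open>0 < n\<close>] by auto
    then obtain v where v: "v \<in> carrier_vec n" "v \<noteq> 0\<^sub>v n" "A *\<^sub>v v = c \<cdot>\<^sub>v v"
      using A by (auto simp: spectrum_def eigenvalue_def eigenvector_def)
    \<comment> \<open>The moduli are carried back from indices to points of \<open>S\<close>, so
      that the real bound \<open>le\<close> applies to them.\<close>
    define f where "f x = norm (v $ the_inv_into {..<n} e x)" for x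
    have f: "f (e i) = norm (v $ i)" if "i < n" for i
      using e that by (simp add: f_def bij_betw_def the_inv_into_f_f)
    have sub: "norm c * f x \<le> (\<Sum>y\<in>S. p x y * f y)" if x: "x \<in> S" for x
    proof -
      obtain i where i: "i < n" "x = e i" using e x unfolding bij_betw_def by blast
      have "norm c * f x = norm ((A *\<^sub>v v) $ i)"
        using i v by (simp add: f norm_mult)
      also have "\<dots> \<le> (\<Sum>j<n. norm (of_real (p (e i) (e j)) * v $ j))"
        using i v(1) by (simp add: Av norm_sum)
      also have "\<dots> = (\<Sum>y\<in>S. p x y * f y)"
        by (simp add: sum_e f i norm_mult p)
      finally show ?thesis .
    qed
    \<comment> \<open>The pointwise inequality \<open>sub\<close> is integrated against the
      nonnegative weight \<open>w x * f x\<close>, which produces the quadratic form.\<close>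
    have "norm c * (\<Sum>x\<in>S. w x * (f x)\<^sup>2) = (\<Sum>x\<in>S. (w x * f x) * (norm c * f x))"
      by (simp add: sum_distrib_left power2_eq_square mult_ac)
    also have "\<dots> \<le> (\<Sum>x\<in>S. (w x * f x) * (\<Sum>y\<in>S. p x y * f y))"
      by (intro sum_mono mult_left_mono sub) (use w in \<open>auto simp: f_def less_imp_le\<close>)
    also have "\<dots> = (\<Sum>x\<in>S. \<Sum>y\<in>S. w x * p x y * f x * f y)"
      by (simp add: sum_distrib_left mult_ac)
    also have "\<dots> \<le> M * (\<Sum>x\<in>S. w x * (f x)\<^sup>2)" by (rule le)
    finally have "norm c * (\<Sum>x\<in>S. w x * (f x)\<^sup>2) \<le> M * (\<Sum>x\<in>S. w x * (f x)\<^sup>2)" .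
    moreover have "0 < (\<Sum>x\<in>S. w x * (f x)\<^sup>2)"
    proof -
      obtain i where "i < n" "v $ i \<noteq> 0"
        using v(1,2) by (metis carrier_vecD eq_vecI index_zero_vec)
      then show ?thesis
        using w eS by (intro sum_pos2[of _ "e i"]) (auto simp: f less_imp_le)
    qed
    ultimately show ?thesis using c(2) by simp
  qed
qed

text \<open>Positivity propagates backwards along edges: if \<open>k v\<close> and
  \<open>p u v\<close> are positive, the eigenvalue equation at \<open>u\<close> excludes
  \<open>k u = 0\<close>.\<close>

lemma nonneg_eigenfunction_pos:
  fixes p :: "'a::finite \<Rightarrow> 'a \<Rightarrow> real"
  assumes p: "\<And>x y. 0 \<le> p x y" and irr: "irreducible_on S (restricted_kernel p S)"
    and k: "\<And>x. x \<in> S \<Longrightarrow> 0 \<le> k x"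
    and eig: "\<And>x. x \<in> S \<Longrightarrow> (\<Sum>y\<in>S. p x y * k y) = M * k x"
    and "z \<in> S" "0 < k z" "x \<in> S"
  shows "0 < k x"
proof -
  have "(x, z) \<in> {(u, v). u \<in> S \<and> v \<in> S \<and> 0 < restricted_kernel p S u v}\<^sup>*"
    using irr \<open>x \<in> S\<close> \<open>z \<in> S\<close> by (auto simp: irreducible_on_def)
  then show ?thesis
  proof (induction rule: converse_rtrancl_induct)
    case base
    then show ?case by fact
  next
    case (step u v)
    show ?case
    proof (cases "u = v")
      case False
      \<comment> \<open>Restricted and killed kernels agree off the diagonal, so irreducibility of
        the former provides edges of the latter.\<close>
      then have uv: "u \<in> S" "v \<in> S" "0 < p u v"
        using step.hyps by (auto simp: restricted_kernel_def)
      have "0 < p u v * k v" using uv step.IH by simp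
      also have "\<dots> \<le> (\<Sum>y\<in>S. p u y * k y)"
        using uv p k by (intro member_le_sum) auto
      also have "\<dots> = M * k u" using uv by (simp add: eig)
      finally show ?thesis using k[OF uv(1)] by (cases "k u = 0") auto
    qed (use step.IH in simp)
  qed
qed

text \<open>Simplicity of the Perron eigenvalue: subtracting the largest multiple of
  \<open>h\<close> that stays below \<open>g\<close> leaves a nonnegative eigenfunction with a zero,
  which must vanish identically by the preceding positivity.\<close>

lemma eigenfunctions_proportional:
  fixes p :: "'a::finite \<Rightarrow> 'a \<Rightarrow> real"
  assumes p: "\<And>x y. 0 \<le> p x y" and irr: "irreducible_on S (restricted_kernel p S)"
    and "S \<noteq> {}" and h: "\<And>x. x \<in> S \<Longrightarrow> 0 < h x"
    and eigh: "\<And>x. x \<in> S \<Longrightarrow> (\<Sum>y\<in>S. p x y * h y) = M * h x"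
    and eigg: "\<And>x. x \<in> S \<Longrightarrow> (\<Sum>y\<in>S. p x y * g y) = M * g x"
  obtains c where "\<And>x. x \<in> S \<Longrightarrow> g x = c * h x"
proof -
  \<comment> \<open>The minimal ratio is attained at some \<open>z\<close>, where
    \<open>g - c * h\<close> touches zero.\<close>
  define c where "c = Min ((\<lambda>x. g x / h x) ` S)"
  have "c \<in> (\<lambda>x. g x / h x) ` S"
    unfolding c_def using \<open>S \<noteq> {}\<close> by (intro Min_in) auto
  then obtain z where z: "z \<in> S" "c = g z / h z" by auto
  define k where "k x = g x - c * h x" for x
  have k: "0 \<le> k x" if "x \<in> S" for x
  proof -
    have "c \<le> g x / h x" unfolding c_def using that by simp
    then show ?thesis using h[OF that] by (simp add: k_def field_simps)
  qed
  have kz: "k z = 0" using z h[of z] by (simp add: k_def)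
  have eigk: "(\<Sum>y\<in>S. p x y * k y) = M * k x" if "x \<in> S" for x
    using eigh[OF that] eigg[OF that]
    by (simp add: k_def right_diff_distrib sum_subtractf mult.left_commute sum_distrib_left[symmetric])
  have "k x = 0" if "x \<in> S" for x
    using nonneg_eigenfunction_pos[OF p irr k eigk that _ z(1)] k[OF that] kz by fastforce
  then show thesis using that[of c] by (simp add: k_def)
qed

text \<open>Resolves the definite description in \<open>mu_star\<close>. Detailed balance turns left
  eigenvectors into right eigenfunctions upon division by \<open>w\<close>; these are proportional,
  and total mass one fixes the factor.\<close>

lemma mu_star_eqI:
  fixes p :: "'a::finite \<Rightarrow> 'a \<Rightarrow> real"
  assumes p: "\<And>x y. 0 \<le> p x y" and irr: "irreducible_on S (restricted_kernel p S)"
    and "S \<noteq> {}" and w: "\<And>x. x \<in> S \<Longrightarrow> 0 < w x"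
    and rev: "\<And>x y. x \<in> S \<Longrightarrow> y \<in> S \<Longrightarrow> w x * p x y = w y * p y x"
    and h: "\<And>x. x \<in> S \<Longrightarrow> 0 < h x"
    and eig: "\<And>x. x \<in> S \<Longrightarrow> (\<Sum>y\<in>S. p x y * h y) = (1 - phi_star p S) * h x"
    and norm: "(\<Sum>x\<in>S. w x * h x) = 1"
    and "x \<in> S"
  shows "pmf (mu_star p S) x = w x * h x"
proof -
  \<comment> \<open>Extension by zero gives a mass function on the whole type.\<close>
  define m where "m x = (if x \<in> S then w x * h x else 0)" for x
  define \<nu> where "\<nu> = embed_pmf m"
  have m0: "0 \<le> m x" for x using w h by (auto simp: m_def less_imp_le)
  have "(\<Sum>x\<in>UNIV. m x) = 1"
    using norm by (simp add: m_def sum.If_cases)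
  then have pmf\<nu>: "pmf \<nu> x = m x" for x
    unfolding \<nu>_def using m0
    by (intro pmf_embed_pmf) (simp_all add: nn_integral_count_space_finite sum_ennreal)
  \<comment> \<open>The killed kernel acts on the measure with density \<open>g\<close> as it acts
    on the function \<open>g\<close>.\<close>
  have dual: "(\<Sum>x\<in>S. w x * g x * p x y) = w y * (\<Sum>x\<in>S. p y x * g x)" if "y \<in> S" for y g
    unfolding sum_distrib_left
  proof (rule sum.cong)
    fix x assume "x \<in> S"
    have "w x * g x * p x y = (w x * p x y) * g x" by simp
    also have "w x * p x y = w y * p y x" using \<open>x \<in> S\<close> that by (rule rev)
    finally show "w x * g x * p x y = w y * (p y x * g x)" by simp
  qed simp
  have "mu_star p S = \<nu>"
    unfolding mu_star_def
  proof (rule the_equality, intro conjI ballI)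
    show "set_pmf \<nu> \<subseteq> S" by (auto simp: set_pmf_eq pmf\<nu> m_def split: if_splits)
    fix y assume "y \<in> S"
    then show "(\<Sum>x\<in>S. pmf \<nu> x * p x y) = (1 - phi_star p S) * pmf \<nu> y"
      using dual[of y h] eig[of y] by (simp add: pmf\<nu> m_def)
  next
    fix \<rho> assume \<rho>: "set_pmf \<rho> \<subseteq> S \<and>
      (\<forall>y\<in>S. (\<Sum>x\<in>S. pmf \<rho> x * p x y) = (1 - phi_star p S) * pmf \<rho> y)"
    define g where "g x = pmf \<rho> x / w x" for x
    have wg: "w x * g x = pmf \<rho> x" if "x \<in> S" for x
      using w[OF that] by (simp add: g_def)
    have eigg: "(\<Sum>y\<in>S. p x y * g y) = (1 - phi_star p S) * g x" if "x \<in> S" for x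
    proof -
      have "w x * (\<Sum>y\<in>S. p x y * g y) = (\<Sum>y\<in>S. pmf \<rho> y * p y x)"
        using dual[OF that, of g] by (simp add: wg)
      also have "\<dots> = w x * ((1 - phi_star p S) * g x)"
        using \<rho> that wg[OF that] by simp
      finally show ?thesis using w[OF that] by simp
    qed
    obtain c where c: "\<And>x. x \<in> S \<Longrightarrow> g x = c * h x"
      using eigenfunctions_proportional[where p=p and S=S and h=h and g=g, OF p irr \<open>S \<noteq> {}\<close> h eig eigg]
      by blast
    have "1 = (\<Sum>x\<in>S. pmf \<rho> x)" using \<rho> by (simp add: sum_pmf_eq_1)
    also have "\<dots> = (\<Sum>x\<in>S. c * (w x * h x))"
      by (rule sum.cong) (simp_all add: wg[symmetric] c)
    also have "\<dots> = c" by (simp add: sum_distrib_left[symmetric] norm)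
    finally have "c = 1" by simp
    show "\<rho> = \<nu>"
    proof (rule pmf_eqI)
      fix x show "pmf \<rho> x = pmf \<nu> x"
      proof (cases "x \<in> S")
        case True
        then show ?thesis using wg[OF True] c[OF True] \<open>c = 1\<close> by (simp add: pmf\<nu> m_def)
      next
        case False
        then show ?thesis using \<rho> by (auto simp: pmf\<nu> m_def set_pmf_eq)
      qed
    qed
  qed
  then show ?thesis using \<open>x \<in> S\<close> by (simp add: pmf\<nu> m_def)
qed

section \<open>Dirichlet form and spectral gap of the restricted process\<close>

text \<open>Expanding the square and merging the two diagonal terms by reversibility, the right side
  exceeds the left by the killing term, the weighted sum of \<open>(f x)^2\<close> times the
  probability of jumping from \<open>x\<close> out of \<open>S\<close>.\<close>

lemma dirichlet_form_le:
  fixes p :: "'a::finite \<Rightarrow> 'a \<Rightarrow> real"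
  assumes "stochastic_kernel p"
    and rev: "\<And>x y. x \<in> S \<Longrightarrow> y \<in> S \<Longrightarrow>
      pmf (cond_pmf \<mu> S) x * p x y = pmf (cond_pmf \<mu> S) y * p y x"
  shows "dirichlet_form p \<mu> S f \<le> (\<Sum>x\<in>S. pmf (cond_pmf \<mu> S) x * (f x)\<^sup>2)
    - (\<Sum>x\<in>S. \<Sum>y\<in>S. pmf (cond_pmf \<mu> S) x * p x y * f x * f y)"
proof -
  define w where "w = pmf (cond_pmf \<mu> S)"
  have p: "0 \<le> p x y" "(\<Sum>y\<in>UNIV. p x y) = 1" for x y
    using assms(1) by (auto simp: stochastic_kernel_def)
  have swap: "(\<Sum>x\<in>S. \<Sum>y\<in>S. w x * p x y * (f y)\<^sup>2) = (\<Sum>x\<in>S. \<Sum>y\<in>S. w x * p x y * (f x)\<^sup>2)"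
    by (subst sum.swap) (intro sum.cong refl, use rev in \<open>simp add: w_def\<close>)
  have "dirichlet_form p \<mu> S f = 1 / 2 * (\<Sum>x\<in>S. \<Sum>y\<in>S. w x * p x y * (f x - f y)\<^sup>2)"
    unfolding dirichlet_form_def w_def
    \<comment> \<open>The kernels differ only on the diagonal, where \<open>f x - f y\<close>
      vanishes.\<close>
    by (intro arg_cong[of _ _ "\<lambda>c. 1 / 2 * c"] sum.cong refl) (auto simp: restricted_kernel_def)
  also have "(\<Sum>x\<in>S. \<Sum>y\<in>S. w x * p x y * (f x - f y)\<^sup>2)
      = (\<Sum>x\<in>S. \<Sum>y\<in>S. w x * p x y * (f x)\<^sup>2 + w x * p x y * (f y)\<^sup>2
          - 2 * (w x * p x y * f x * f y))"
    by (intro sum.cong refl) (simp add: power2_diff algebra_simps)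
  also have "\<dots> = (\<Sum>x\<in>S. \<Sum>y\<in>S. w x * p x y * (f x)\<^sup>2) + (\<Sum>x\<in>S. \<Sum>y\<in>S. w x * p x y * (f y)\<^sup>2)
        - 2 * (\<Sum>x\<in>S. \<Sum>y\<in>S. w x * p x y * f x * f y)"
    by (simp only: sum.distrib sum_subtractf sum_distrib_left)
  finally have "dirichlet_form p \<mu> S f = (\<Sum>x\<in>S. \<Sum>y\<in>S. w x * p x y * (f x)\<^sup>2)
      - (\<Sum>x\<in>S. \<Sum>y\<in>S. w x * p x y * f x * f y)"
    using swap by simp
  moreover have "(\<Sum>x\<in>S. \<Sum>y\<in>S. w x * p x y * (f x)\<^sup>2) \<le> (\<Sum>x\<in>S. w x * (f x)\<^sup>2)"
  proof (rule sum_mono)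
    fix x
    have "(\<Sum>y\<in>S. p x y) \<le> 1"
      using sum_mono2[of UNIV S "p x"] p by simp
    then have "(w x * (f x)\<^sup>2) * (\<Sum>y\<in>S. p x y) \<le> w x * (f x)\<^sup>2"
      by (intro mult_left_le) (simp_all add: w_def)
    then show "(\<Sum>y\<in>S. w x * p x y * (f x)\<^sup>2) \<le> w x * (f x)\<^sup>2"
      unfolding sum_distrib_left by (simp add: mult_ac)
  qed
  ultimately show ?thesis by (simp add: w_def)
qed

lemma dirichlet_form_nonneg:
  assumes "stochastic_kernel p"
  shows "0 \<le> dirichlet_form p \<mu> S f"
  using assms
  by (auto simp: dirichlet_form_def restricted_kernel_def stochastic_kernel_def
      intro!: sum_nonneg mult_nonneg_nonneg add_nonneg_nonneg)

lemma set_cond_pmf_eq: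
  assumes "S \<subseteq> set_pmf \<mu>" "S \<noteq> {}"
  shows "set_pmf (cond_pmf \<mu> S) = S"
  using assms by (subst set_cond_pmf) auto

text \<open>Along a path from \<open>x\<close> to \<open>y\<close>, each edge with positive rate
  controls the increment of \<open>f\<close> across it; the constant depends on the path but not on
  \<open>f\<close>.\<close>

lemma square_diff_le_dirichlet_form:
  fixes p :: "'a::finite \<Rightarrow> 'a \<Rightarrow> real"
  assumes st: "stochastic_kernel p" and S: "S \<subseteq> set_pmf \<mu>"
    and irr: "irreducible_on S (restricted_kernel p S)" and "x \<in> S" "y \<in> S"
  obtains C where "\<And>f. (f x - f y)\<^sup>2 \<le> C * dirichlet_form p \<mu> S f"
proof -
  define r where "r = restricted_kernel p S"
  define w where "w = pmf (cond_pmf \<mu> S)"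
  have r: "0 \<le> r u v" for u v
    using st by (auto simp: r_def restricted_kernel_def stochastic_kernel_def
        intro!: sum_nonneg add_nonneg_nonneg)
  have w: "0 < w u" if "u \<in> S" for u
    using that set_cond_pmf_eq[OF S] by (auto simp: w_def pmf_positive_iff)
  have "(x, y) \<in> {(u, v). u \<in> S \<and> v \<in> S \<and> 0 < r u v}\<^sup>*"
    using irr \<open>x \<in> S\<close> \<open>y \<in> S\<close> by (auto simp: irreducible_on_def r_def)
  then have "\<exists>C. \<forall>f. (f x - f y)\<^sup>2 \<le> C * dirichlet_form p \<mu> S f"
  proof (induction rule: rtrancl_induct)
    case base
    then show ?case by (intro exI[of _ 0]) simp
  next
    case (step u v)
    then obtain C where C: "\<And>f. (f x - f u)\<^sup>2 \<le> C * dirichlet_form p \<mu> S f" by auto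
    have uv: "u \<in> S" "v \<in> S" "0 < r u v" using step by auto
    \<comment> \<open>The conductance of the edge. The single term of the edge is at most the full
      double sum, which is twice the Dirichlet form; hence the factor \<open>2 / a\<close>
      below.\<close>
    define a where "a = w u * r u v"
    have a: "0 < a" using uv w by (simp add: a_def)
    have edge: "(f u - f v)\<^sup>2 \<le> 2 / a * dirichlet_form p \<mu> S f" for f
    proof -
      have "a * (f u - f v)\<^sup>2 \<le> (\<Sum>v\<in>S. w u * r u v * (f u - f v)\<^sup>2)"
        unfolding a_def using uv r by (intro member_le_sum) (auto simp: w_def)
      also have "\<dots> \<le> (\<Sum>u\<in>S. \<Sum>v\<in>S. w u * r u v * (f u - f v)\<^sup>2)"
        by (rule member_le_sum[of u S "\<lambda>u. \<Sum>v\<in>S. w u * r u v * (f u - f v)\<^sup>2"])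
          (use uv r in \<open>auto simp: w_def intro!: sum_nonneg\<close>)
      also have "\<dots> = 2 * dirichlet_form p \<mu> S f" by (simp add: dirichlet_form_def w_def r_def)
      finally show ?thesis using a by (simp add: field_simps)
    qed
    have "(f x - f v)\<^sup>2 \<le> (2 * C + 4 / a) * dirichlet_form p \<mu> S f" for f
    proof -
      \<comment> \<open>This yields \<open>(s + t)^2 \<le> 2 * s^2 + 2 * t^2\<close>, so the
        constant grows from \<open>C\<close> to \<open>2 * C + 2 * (2 / a)\<close>.\<close>
      have "0 \<le> ((f x - f u) - (f u - f v))\<^sup>2" by simp
      then have "(f x - f v)\<^sup>2 \<le> 2 * (f x - f u)\<^sup>2 + 2 * (f u - f v)\<^sup>2"
        by (simp add: power2_eq_square algebra_simps)
      also have "\<dots> \<le> 2 * (C * dirichlet_form p \<mu> S f) + 2 * (2 / a * dirichlet_form p \<mu> S f)"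
        by (intro add_mono mult_left_mono C edge) simp_all
      also have "\<dots> = (2 * C + 4 / a) * dirichlet_form p \<mu> S f" by (simp add: algebra_simps)
      finally show ?thesis .
    qed
    then show ?case by blast
  qed
  then show thesis using that by blast
qed

lemma expectation_cond_pmf:
  fixes \<mu> :: "'a::finite pmf" and f :: "'a \<Rightarrow> real"
  assumes "S \<subseteq> set_pmf \<mu>" "S \<noteq> {}"
  shows "measure_pmf.expectation (cond_pmf \<mu> S) f = (\<Sum>x\<in>S. pmf (cond_pmf \<mu> S) x * f x)"
  using set_cond_pmf_eq[OF assms]
  by (subst integral_measure_pmf_real[of S]) (auto simp: mult.commute)

text \<open>The variance is at most the mean square deviation from the value at any fixed point
  \<open>z\<close>, and each such deviation is controlled by the path bound.\<close>

lemma poincare_inequality: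
  fixes p :: "'a::finite \<Rightarrow> 'a \<Rightarrow> real"
  assumes st: "stochastic_kernel p" and S: "S \<subseteq> set_pmf \<mu>" "S \<noteq> {}"
    and irr: "irreducible_on S (restricted_kernel p S)"
  obtains C where "0 < C"
    and "\<And>f. measure_pmf.variance (cond_pmf \<mu> S) f \<le> C * dirichlet_form p \<mu> S f"
proof -
  define w where "w = pmf (cond_pmf \<mu> S)"
  have w0: "0 \<le> w x" for x by (simp add: w_def)
  have w1: "(\<Sum>x\<in>S. w x) = 1"
    unfolding w_def using set_cond_pmf_eq[OF S] by (intro sum_pmf_eq_1) auto
  have "\<forall>x y. \<exists>C. x \<in> S \<longrightarrow> y \<in> S \<longrightarrow> (\<forall>f. (f x - f y)\<^sup>2 \<le> C * dirichlet_form p \<mu> S f)"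
    by (metis square_diff_le_dirichlet_form[OF st S(1) irr])
  then obtain C where C: "\<And>x y f. x \<in> S \<Longrightarrow> y \<in> S \<Longrightarrow> (f x - f y)\<^sup>2 \<le> C x y * dirichlet_form p \<mu> S f"
    by metis
  obtain z where "z \<in> S" using S by auto
  define D where "D = (\<Sum>x\<in>S. w x * C x z)"
  have var: "measure_pmf.variance (cond_pmf \<mu> S) f \<le> D * dirichlet_form p \<mu> S f" for f
  proof -
    define m where "m = (\<Sum>x\<in>S. w x * f x)"
    have "measure_pmf.variance (cond_pmf \<mu> S) f = (\<Sum>x\<in>S. w x * (f x - m)\<^sup>2)"
      by (simp add: expectation_cond_pmf[OF S] w_def m_def)
    also have "\<dots> = (\<Sum>x\<in>S. w x * (f x - f z)\<^sup>2 + (2 * (f z - m)) * (w x * f x)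
        + w x * (m\<^sup>2 - (f z)\<^sup>2))"
      by (intro sum.cong) (simp_all add: power2_eq_square algebra_simps)
    also have "\<dots> = (\<Sum>x\<in>S. w x * (f x - f z)\<^sup>2) + (2 * (f z - m)) * (\<Sum>x\<in>S. w x * f x)
        + (\<Sum>x\<in>S. w x) * (m\<^sup>2 - (f z)\<^sup>2)"
      by (simp only: sum.distrib sum_distrib_left sum_distrib_right)
    also have "\<dots> = (\<Sum>x\<in>S. w x * (f x - f z)\<^sup>2) - (f z - m)\<^sup>2"
      unfolding w1 m_def[symmetric] by (simp add: power2_eq_square algebra_simps)
    also have "\<dots> \<le> (\<Sum>x\<in>S. w x * (f x - f z)\<^sup>2)" by simp
    also have "\<dots> \<le> (\<Sum>x\<in>S. w x * (C x z * dirichlet_form p \<mu> S f))"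
      by (intro sum_mono mult_left_mono C w0 \<open>z \<in> S\<close>)
    also have "\<dots> = D * dirichlet_form p \<mu> S f"
      by (simp add: D_def sum_distrib_right mult.assoc)
    finally show ?thesis .
  qed
  show thesis
  \<comment> \<open>The maximum with 1 makes the constant positive; enlarging it is harmless because
    the Dirichlet form is nonnegative.\<close>
  proof (rule that[of "max 1 D"])
    fix f
    show "measure_pmf.variance (cond_pmf \<mu> S) f \<le> max 1 D * dirichlet_form p \<mu> S f"
      using var[of f] mult_right_mono[OF _ dirichlet_form_nonneg[OF st], of D "max 1 D" \<mu> S f]
      by (smt (verit) max.cobounded2)
  qed simp
qed

text \<open>A Poincare constant \<open>C\<close> bounds every quotient below by
  \<open>1 / C\<close>, and this passes to the infimum once a function of nonzero variance is
  exhibited.\<close>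

lemma spectral_gap_pos:
  fixes p :: "'a::finite \<Rightarrow> 'a \<Rightarrow> real"
  assumes st: "stochastic_kernel p" and S: "S \<subseteq> set_pmf \<mu>" "2 \<le> card S"
    and irr: "irreducible_on S (restricted_kernel p S)"
  shows "0 < spectral_gap p \<mu> S"
proof -
  have "S \<noteq> {}" using S by auto
  define V where "V f = measure_pmf.variance (cond_pmf \<mu> S) f" for f :: "'a \<Rightarrow> real"
  obtain C where C: "0 < C" "\<And>f. V f \<le> C * dirichlet_form p \<mu> S f"
    unfolding V_def using poincare_inequality[OF st S(1) \<open>S \<noteq> {}\<close> irr] by metis
  have V0: "0 \<le> V f" for f unfolding V_def by (rule measure_pmf.variance_positive)
  obtain a b where ab: "a \<in> S" "b \<in> S" "a \<noteq> b"
    using S(2) by (metis One_nat_def Suc_1 card_le_Suc0_iff_eq finite not_less_eq_eq)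
  define w where "w = pmf (cond_pmf \<mu> S)"
  \<comment> \<open>The indicator of one of two distinct points has nonzero variance, so the infimum
    is over a nonempty set.\<close>
  define f where "f x = (if x = a then 1 else 0 :: real)" for x
  have w: "0 < w x" if "x \<in> S" for x
    using that set_cond_pmf_eq[OF S(1) \<open>S \<noteq> {}\<close>] by (auto simp: w_def pmf_positive_iff)
  define m where "m = (\<Sum>x\<in>S. w x * f x)"
  have Vf: "V f = (\<Sum>x\<in>S. w x * (f x - m)\<^sup>2)"
    by (simp add: V_def expectation_cond_pmf[OF S(1) \<open>S \<noteq> {}\<close>] w_def m_def)
  have "V f \<noteq> 0"
  proof
    assume "V f = 0"
    then have "\<forall>x\<in>S. w x * (f x - m)\<^sup>2 = 0"
      unfolding Vf using w by (subst (asm) sum_nonneg_eq_0_iff) (auto simp: less_imp_le)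
    then have "f x = m" if "x \<in> S" for x using w[OF that] that by fastforce
    from this[OF ab(1)] this[OF ab(2)] show False using ab by (simp add: f_def)
  qed
  then have "1 / C \<le> spectral_gap p \<mu> S"
    unfolding spectral_gap_def V_def[symmetric]
  proof (intro cInf_greatest)
    fix q assume "q \<in> {dirichlet_form p \<mu> S f / V f |f. V f \<noteq> 0}"
    then obtain g where g: "q = dirichlet_form p \<mu> S g / V g" "V g \<noteq> 0" by auto
    then have "0 < V g" using V0[of g] by linarith
    then show "1 / C \<le> q" using C(1) C(2)[of g] by (simp add: g(1) field_simps)
  qed auto
  with C show ?thesis by (meson less_le_trans zero_less_divide_1_iff)
qed

lemma spectral_gap_variance_le:
  assumes st: "stochastic_kernel p"
  shows "spectral_gap p \<mu> S * measure_pmf.variance (cond_pmf \<mu> S) f \<le> dirichlet_form p \<mu> S f"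
proof (cases "measure_pmf.variance (cond_pmf \<mu> S) f = 0")
  case True
  then show ?thesis using dirichlet_form_nonneg[OF st] by simp
next
  case False
  then have pos: "0 < measure_pmf.variance (cond_pmf \<mu> S) f"
    using measure_pmf.variance_positive[of "cond_pmf \<mu> S" f] by linarith
  have "spectral_gap p \<mu> S \<le> dirichlet_form p \<mu> S f / measure_pmf.variance (cond_pmf \<mu> S) f"
    unfolding spectral_gap_def
  proof (rule cInf_lower)
    show "bdd_below {dirichlet_form p \<mu> S f / measure_pmf.variance (cond_pmf \<mu> S) f | f.
            measure_pmf.variance (cond_pmf \<mu> S) f \<noteq> 0}"
      using dirichlet_form_nonneg[OF st]
      by (intro bdd_belowI[of _ 0]) (auto intro!: divide_nonneg_nonneg measure_pmf.variance_positive)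
  qed (use False in auto)
  then show ?thesis using pos by (simp add: field_simps)
qed

section \<open>Identification of \<open>h_star\<close> as the Perron eigenfunction\<close>

text \<open>By detailed balance, positivity of \<open>\<mu>\<close> passes along every edge, and
  irreducibility carries it everywhere.\<close>

lemma reversible_set_pmf:
  fixes p :: "'a::finite \<Rightarrow> 'a \<Rightarrow> real"
  assumes "irreducible_on UNIV p" "reversible p \<mu>"
  shows "set_pmf \<mu> = UNIV"
proof -
  obtain x where x: "x \<in> set_pmf \<mu>" using set_pmf_not_empty[of \<mu>] by auto
  have "y \<in> set_pmf \<mu>" for y
  proof -
    have "(x, y) \<in> {(u, v). u \<in> UNIV \<and> v \<in> UNIV \<and> 0 < p u v}\<^sup>*"
      using assms(1) by (auto simp: irreducible_on_def)
    then show ?thesis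
    proof (induction rule: rtrancl_induct)
      case (step u v)
      then have "pmf \<mu> u * p u v \<noteq> 0" by (auto simp: set_pmf_eq)
      then have "pmf \<mu> v * p v u \<noteq> 0" using assms(2) by (metis reversible_def)
      then show ?case by (auto simp: set_pmf_eq)
    qed (rule x)
  qed
  then show ?thesis by auto
qed

text \<open>The Rayleigh maximizer for the symmetric kernel \<open>w x * p x y\<close> is a positive
  eigenfunction for the spectral radius; normalized to mean one, it is the density of
  \<open>mu_star\<close>.\<close>

lemma h_star_eigenfunction:
  fixes p :: "'a::finite \<Rightarrow> 'a \<Rightarrow> real"
  assumes st: "stochastic_kernel p" and S: "S \<subseteq> set_pmf \<mu>" "S \<noteq> {}"
    and irr: "irreducible_on S (restricted_kernel p S)"
    and rev: "\<And>x y. x \<in> S \<Longrightarrow> y \<in> S \<Longrightarrow>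
      pmf (cond_pmf \<mu> S) x * p x y = pmf (cond_pmf \<mu> S) y * p y x"
  shows "(\<Sum>x\<in>S. pmf (cond_pmf \<mu> S) x * h_star p \<mu> S x) = 1"
    and "\<And>x. x \<in> S \<Longrightarrow> (\<Sum>y\<in>S. p x y * h_star p \<mu> S y) = (1 - phi_star p S) * h_star p \<mu> S x"
proof -
  define w where "w = pmf (cond_pmf \<mu> S)"
  have p: "0 \<le> p x y" for x y using st by (simp add: stochastic_kernel_def)
  have w: "0 < w x" if "x \<in> S" for x
    using that set_cond_pmf_eq[OF S] by (auto simp: w_def pmf_positive_iff)
  have rev': "w x * p x y = w y * p y x" if "x \<in> S" "y \<in> S" for x y
    unfolding w_def using that by (rule rev)
  obtain M h where h0: "\<And>x. 0 \<le> h x" "\<exists>x\<in>S. 0 < h x"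
    and max: "(\<Sum>x\<in>S. \<Sum>y\<in>S. w x * p x y * h x * h y) = M * (\<Sum>x\<in>S. w x * (h x)\<^sup>2)"
      "\<And>f. (\<Sum>x\<in>S. \<Sum>y\<in>S. w x * p x y * f x * f y) \<le> M * (\<Sum>x\<in>S. w x * (f x)\<^sup>2)"
    by (rule rayleigh_maximizer[of S "\<lambda>x y. w x * p x y" w])
      (use S(2) p w in \<open>auto simp: less_imp_le\<close>)
  have eig: "(\<Sum>y\<in>S. p x y * h y) = M * h x" if "x \<in> S" for x
  proof -
    have "w x * (\<Sum>y\<in>S. p x y * h y) = (\<Sum>y\<in>S. w x * p x y * h y)"
      by (simp add: sum_distrib_left mult.assoc)
    also have "\<dots> = M * (w x * h x)"
      by (rule rayleigh_maximizer_eigenfunction[OF _ _ max that]) (simp_all add: rev')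
    finally show ?thesis using w[OF that] by simp
  qed
  obtain z where z: "z \<in> S" "0 < h z" using h0 by auto
  then have M: "1 - phi_star p S = M"
    using spectral_radius_killed_matrix[OF p w z(1) _ eig max(2)] by (simp add: phi_star_def)
  have hpos: "0 < h x" if "x \<in> S" for x
    by (rule nonneg_eigenfunction_pos[OF p irr h0(1) eig z that])
  \<comment> \<open>Dividing by the mean \<open>c\<close> makes \<open>w x * (h x / c)\<close> a
    probability.\<close>
  define c where "c = (\<Sum>x\<in>S. w x * h x)"
  have c: "0 < c" unfolding c_def using S(2) w hpos by (intro sum_pos) auto
  have hs: "h_star p \<mu> S x = h x / c" if "x \<in> S" for x
  proof -
    have "pmf (mu_star p S) x = w x * (h x / c)"
    proof (rule mu_star_eqI[OF p irr S(2) w rev'])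
      show "(\<Sum>y\<in>S. p x y * (h y / c)) = (1 - phi_star p S) * (h x / c)" if "x \<in> S" for x
        using eig[OF that] by (simp add: M sum_divide_distrib[symmetric])
      show "(\<Sum>x\<in>S. w x * (h x / c)) = 1"
        using c by (simp add: sum_divide_distrib[symmetric] c_def[symmetric])
    qed (use hpos c that in auto)
    then show ?thesis using w[OF that] by (simp add: h_star_def w_def)
  qed
  show "(\<Sum>x\<in>S. pmf (cond_pmf \<mu> S) x * h_star p \<mu> S x) = 1"
    using c by (simp add: hs w_def[symmetric] sum_divide_distrib[symmetric] c_def[symmetric])
  show "(\<Sum>y\<in>S. p x y * h_star p \<mu> S y) = (1 - phi_star p S) * h_star p \<mu> S x" if "x \<in> S" for x
    using eig[OF that] that by (simp add: hs M sum_divide_distrib[symmetric])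
qed

section \<open>The variance bound\<close>

theorem proposition2p1:
  fixes p :: "'a::finite \<Rightarrow> 'a \<Rightarrow> real" and \<mu> :: "'a pmf" and R :: "'a set"
  assumes "stochastic_kernel p"
    and "irreducible_on UNIV p"
    and "reversible p \<mu>"
    and "R \<subset> UNIV" and "2 \<le> card R"
    and "irreducible_on R (restricted_kernel p R)"
    and "irreducible_on (- R) (restricted_kernel p (- R))"
    and "eps_star p \<mu> R < 1"
  shows "measure_pmf.variance (cond_pmf \<mu> R) (h_star p \<mu> R)
           = (norm_restr \<mu> R (\<lambda>x. h_star p \<mu> R x - indicator R x))\<^sup>2
       \<and> (norm_restr \<mu> R (\<lambda>x. h_star p \<mu> R x - indicator R x))\<^sup>2
           \<le> eps_star p \<mu> R / (1 - eps_star p \<mu> R)"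
proof -
  define w where "w = pmf (cond_pmf \<mu> R)"
  define h where "h = h_star p \<mu> R"
  define \<phi> where "\<phi> = phi_star p R"
  define \<gamma> where "\<gamma> = spectral_gap p \<mu> R"
  define V where "V = measure_pmf.variance (cond_pmf \<mu> R) h"
  have R: "R \<subseteq> set_pmf \<mu>" "R \<noteq> {}"
    using reversible_set_pmf[OF assms(2,3)] assms(5) by auto
  \<comment> \<open>Conditioning divides both sides of detailed balance by the same mass of
    \<open>R\<close>.\<close>
  have rev: "w x * p x y = w y * p y x" if "x \<in> R" "y \<in> R" for x y
  proof -
    have "R \<inter> set_pmf \<mu> \<noteq> {}" using R by auto
    moreover have "pmf \<mu> x * p x y = pmf \<mu> y * p y x"
      using assms(3) by (simp add: reversible_def)
    ultimately show ?thesis using that by (simp add: w_def pmf_cond Int_commute)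
  qed
  note eig = h_star_eigenfunction[OF assms(1) R assms(6) rev[unfolded w_def],
      folded w_def h_def \<phi>_def]
  have w1: "(\<Sum>x\<in>R. w x) = 1"
    unfolding w_def using set_cond_pmf_eq[OF R] by (intro sum_pmf_eq_1) auto
  \<comment> \<open>\<open>h\<close> has mean one because it is a probability density; on
    \<open>R\<close> the constant 1 is the indicator, which yields the claimed equality.\<close>
  have V1: "V = (\<Sum>x\<in>R. w x * (h x - 1)\<^sup>2)"
    using eig(1) by (simp add: V_def expectation_cond_pmf[OF R] w_def)
  have norm: "(norm_restr \<mu> R (\<lambda>x. h x - indicator R x))\<^sup>2 = V"
    unfolding norm_restr_def V1 w_def by (simp add: sum_nonneg)
  have V2: "(\<Sum>x\<in>R. w x * (h x)\<^sup>2) = V + 1"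
  proof -
    have "V = (\<Sum>x\<in>R. w x * (h x)\<^sup>2) - 2 * (\<Sum>x\<in>R. w x * h x) + (\<Sum>x\<in>R. w x)"
      unfolding V1 sum_distrib_left sum_subtractf[symmetric] sum.distrib[symmetric]
      by (intro sum.cong) (simp_all add: power2_eq_square algebra_simps)
    then show ?thesis using eig(1) w1 by simp
  qed
  have "\<gamma> * V \<le> dirichlet_form p \<mu> R h"
    unfolding \<gamma>_def V_def by (rule spectral_gap_variance_le[OF assms(1)])
  also have "\<dots> \<le> (\<Sum>x\<in>R. w x * (h x)\<^sup>2) - (\<Sum>x\<in>R. \<Sum>y\<in>R. w x * p x y * h x * h y)"
    unfolding w_def by (rule dirichlet_form_le[OF assms(1) rev[unfolded w_def]])
  also have "(\<Sum>x\<in>R. \<Sum>y\<in>R. w x * p x y * h x * h y) = (\<Sum>x\<in>R. w x * h x * (\<Sum>y\<in>R. p x y * h y))"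
    by (simp add: sum_distrib_left mult_ac)
  \<comment> \<open>The eigenvalue equation evaluates the quadratic form at \<open>h\<close>,
    leaving \<open>\<phi>\<close> times the squared norm \<open>V + 1\<close>.\<close>
  also have "\<dots> = (1 - \<phi>) * (\<Sum>x\<in>R. w x * (h x)\<^sup>2)"
    unfolding sum_distrib_left
    by (intro sum.cong) (simp_all add: eig(2) sum_distrib_left[symmetric] power2_eq_square)
  finally have "\<gamma> * V \<le> \<phi> * (V + 1)" by (simp add: V2 algebra_simps)
  moreover have "0 < \<gamma>"
    unfolding \<gamma>_def by (rule spectral_gap_pos[OF assms(1) R(1) assms(5,6)])
  ultimately have "V \<le> \<phi> / \<gamma> * (V + 1)" by (simp add: field_simps)
  then have "V * (1 - eps_star p \<mu> R) \<le> eps_star p \<mu> R"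
    unfolding eps_star_def \<phi>_def[symmetric] \<gamma>_def[symmetric] by argo
  \<comment> \<open>Here \<open>eps_star p \<mu> R < 1\<close> makes the divisor positive.\<close>
  then have "V \<le> eps_star p \<mu> R / (1 - eps_star p \<mu> R)"
    using assms(8) by (simp add: pos_le_divide_eq)
  then show ?thesis using norm by (simp add: V_def h_def)
qed

end
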